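(* For all $k\ge0$, \[ D_k:=\sum_{v=4^k}^{4^{k+1}-1}\bigl(F_A(v)-F_B(v)\bigr)=\binom{2k+2}{k+1}. \]
   Context: Let $\widetilde Q(1)=\widetilde Q(2)=1$ and $\widetilde Q(n)=\widetilde Q(n-\widetilde Q(n-1))+\widetilde Q(n-\widetilde Q(n-2))+(-1)^n$ for $n\ge3$ (well defined, all values odd). Put $A(m):=(\widetilde Q(2m-1)+1)/2$ and $B(m):=(\widetilde Q(2m)+1)/2$ for $m\ge1$. For $v\in\mathbb{N}$ let $F_A(v):=\#\{m\ge1:A(m)=v\}$ and $F_B(v):=\#\{m\ge1:B(m)=v\}$ (these are finite). *)

theory Defs
  imports Complex_Main
begin

text \<open>
  The recursion is nested, so its arguments \<open>n - Q(n-1)\<close> and \<open>n - Q(n-2)\<close> have to be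
  guarded in a total function: the recursion equation is used when both lie in
  \<open>{1..<n}\<close>, and the junk value 0 is returned otherwise. The sequence is in fact well
  defined, that is, the guard holds for all \<open>n \<ge> 3\<close>. Index 0 is not part of the sequence.
\<close>

function Qt :: "nat \<Rightarrow> int" where
  "Qt n =
    (if n = 0 then 0
     else if n \<le> 2 then 1
     else if 1 \<le> Qt (n - 1) \<and> Qt (n - 1) < int n \<and> 1 \<le> Qt (n - 2) \<and> Qt (n - 2) < int n
     then Qt (nat (int n - Qt (n - 1))) + Qt (nat (int n - Qt (n - 2))) + (-1) ^ n
     else 0)"
  by pat_completeness auto
termination
  by (relation "measure (\<lambda>n. n)") auto

declare Qt.simps [simp del]

text \<open>All values of the sequence are odd, so the integer divisions below are exact.\<close>

definition A :: "nat \<Rightarrow> int" where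
  "A m = (Qt (2 * m - 1) + 1) div 2"

definition B :: "nat \<Rightarrow> int" where
  "B m = (Qt (2 * m) + 1) div 2"

definition F_A :: "nat \<Rightarrow> nat" where
  "F_A v = card {m. m \<ge> 1 \<and> A m = int v}"

definition F_B :: "nat \<Rightarrow> nat" where
  "F_B v = card {m. m \<ge> 1 \<and> B m = int v}"

end

theory Submission
  imports Defs
begin

text \<open>
  Record the increments of the sequence along its odd indices as letters \<open>True\<close> and those along its
  even indices as letters \<open>False\<close>, in the order in which they occur. The resulting infinite word
  \<open>letter\<close> satisfies a Conway-like rule: if position \<open>n\<close> carries the \<open>r\<close>-th occurrence of its
  letter, then position \<open>n + 1\<close> carries the negation of \<open>letter r\<close>. If \<open>f\<close> and \<open>g\<close> denote the
  positions of the \<open>r\<close>-th \<open>True\<close> and of the \<open>r\<close>-th \<open>False\<close>, counting runs gives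
  \<open>f (f r) = f r + g r\<close> and \<open>g (g (r + 1)) = f r + g (r + 1)\<close>. Applying \<open>f\<close> and \<open>g\<close> alternately to
  \<open>4 ^ k\<close> yields sequences \<open>x k l\<close> with \<open>x k (l + 1) = x k l + x (k - 1) (l + 2)\<close> up to a simple
  correction. This is Pascal's rule, so that \<open>f (4 ^ k - 1) - g (4 ^ k - 1)\<close> is the sum of the
  central binomial coefficients \<open>(2 * m + 2) choose (m + 1)\<close> with \<open>m < k\<close>. This difference is also the
  difference of the indices at which \<open>A\<close> and \<open>B\<close> first reach \<open>4 ^ k\<close>.
\<close>

section \<open>The word of increments\<close>

text \<open>The next letter depends on an earlier one at an index that is itself a count of letters,
  so the recursion carries the whole prefix. Index 0 and all indices beyond \<open>n\<close> hold
  the default \<open>False\<close>.\<close>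

primrec hist :: "nat \<Rightarrow> nat \<Rightarrow> bool" where
  "hist 0 = (\<lambda>_. False)"
| "hist (Suc n) = (hist n)(Suc n := n \<ge> 1 \<and> \<not> hist n (card {j \<in> {1..n}. hist n j = hist n n}))"

definition letter :: "nat \<Rightarrow> bool" where
  "letter n = hist n n"

definition num :: "bool \<Rightarrow> nat \<Rightarrow> nat" where
  "num c n = card {j \<in> {1..n}. letter j = c}"

definition occ :: "bool \<Rightarrow> nat \<Rightarrow> nat \<Rightarrow> bool" where
  "occ c r i \<longleftrightarrow> 1 \<le> i \<and> letter i = c \<and> num c i = r"

lemma hist_eq_letter: "j \<le> n \<Longrightarrow> hist n j = letter j"
  by (induction n) (auto simp: letter_def le_Suc_eq)

lemma num_0 [simp]: "num c 0 = 0"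
  by (simp add: num_def)

lemma num_Suc: "num c (Suc n) = num c n + (if letter (Suc n) = c then 1 else 0)"
proof -
  have "{j \<in> {1..Suc n}. letter j = c} =
      (if letter (Suc n) = c then insert (Suc n) {j \<in> {1..n}. letter j = c} else {j \<in> {1..n}. letter j = c})"
    by (auto simp: le_Suc_eq)
  then show ?thesis by (simp add: num_def)
qed

lemma num_compl: "num True n + num False n = n"
  by (induction n) (auto simp: num_Suc)

lemma num_compl': "num c n + num (\<not> c) n = n"
  using num_compl [of n] by (cases c) auto

lemma num_mono: "m \<le> n \<Longrightarrow> num c m \<le> num c n"
  by (induction n) (auto simp: num_Suc le_Suc_eq)

lemma num_le: "num c n \<le> n"
  using num_compl' [of c n] by linarith

lemma letter_0 [simp]: "letter 0 = False"
  by (simp add: letter_def)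

lemma letter_1 [simp]: "letter (Suc 0) = False"
  by (simp add: letter_def)

lemma letter_Suc:
  assumes "n \<ge> 1"
  shows "letter (Suc n) = (\<not> letter (num (letter n) n))"
proof -
  have "letter (Suc n) = (\<not> hist n (card {j \<in> {1..n}. hist n j = hist n n}))"
    using assms by (simp add: letter_def)
  also have "{j \<in> {1..n}. hist n j = hist n n} = {j \<in> {1..n}. letter j = letter n}"
    by (auto simp: hist_eq_letter)
  finally show ?thesis
    using num_le [of "letter n" n] by (simp add: num_def hist_eq_letter)
qed

lemma occ_num: "occ c r i \<Longrightarrow> num c i = r"
  and occ_letter: "occ c r i \<Longrightarrow> letter i = c"
  and occ_pos: "occ c r i \<Longrightarrow> 1 \<le> i"
  by (auto simp: occ_def)

lemma occ_next: "occ c r i \<Longrightarrow> letter (Suc i) = (\<not> letter r)"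
  using letter_Suc by (auto simp: occ_def)

lemma occ_num_less:
  assumes "occ c r i" "j < i"
  shows "num c j < r"
proof -
  obtain i' where i': "i = Suc i'" using assms by (cases i) auto
  then have "num c j \<le> num c i'" using assms num_mono by auto
  then show ?thesis using assms i' by (auto simp: occ_def num_Suc)
qed

lemma occ_num_ge: "occ c r i \<Longrightarrow> i \<le> j \<Longrightarrow> r \<le> num c j"
  using num_mono by (auto simp: occ_def)

lemma occ_le_iff: "occ c r i \<Longrightarrow> r \<le> num c j \<longleftrightarrow> i \<le> j"
  by (meson leD leI occ_num_ge occ_num_less)

lemma occ_less_iff:
  assumes "occ c r i" "occ c s j"
  shows "r < s \<longleftrightarrow> i < j"
  using assms occ_le_iff [OF assms(2), of i] occ_num [OF assms(1)] by auto

text \<open>Runs alternate and start with a run of \<open>False\<close>. By the recursion, the \<open>r\<close>-th \<open>c\<close> closes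
  a run iff \<open>letter r = c\<close>, so both sides below count closed runs.\<close>

lemma closed_runs:
  "num False (num False n) = num True (num True n) + (if letter (Suc n) then 1 else 0)"
proof (induction n)
  case (Suc n)
  have "letter (Suc (Suc n)) = (\<not> letter (num (letter (Suc n)) (Suc n)))"
    by (rule letter_Suc) simp
  with Suc show ?case
    by (cases "letter (Suc n)") (auto simp: num_Suc)
qed simp

section \<open>Ends of runs: peaks and valleys of the word\<close>

lemma num_step_ex:
  assumes "k < num c n"
  obtains i where "i < n" "num c i = k" "letter (Suc i) = c"
proof -
  have "\<exists>i<n. num c i = k \<and> letter (Suc i) = c"
    using assms
  proof (induction n)
    case (Suc n)
    then show ?case
      by (cases "k < num c n") (auto simp: num_Suc less_Suc_eq split: if_splits)
  qed simp
  then show thesis using that by blast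
qed

text \<open>Any other split of the first \<open>s + t\<close> letters would put the two sides of
  \<open>closed_runs\<close> on incompatible sides of \<open>r\<close>.\<close>

lemma num_at_peak:
  assumes s: "occ True r s" and t: "occ False r t"
  shows "num True (s + t) = s"
proof (rule ccontr)
  let ?x = "num True (s + t)" and ?y = "num False (s + t)"
  have xy: "?x + ?y = s + t" by (rule num_compl)
  assume "?x \<noteq> s"
  then consider "s < ?x" | "?x < s" by linarith
  then show False
  proof cases
    case 1
    then have "num False ?y < r" using occ_num_less [OF t, of ?y] xy by linarith
    moreover have "r \<le> num True ?x" using occ_num_ge [OF s, of ?x] 1 by linarith
    ultimately show False using closed_runs [of "s + t"] by linarith
  next
    case 2
    then have "t < ?y" using xy by linarith
    \<comment> \<open>At \<open>s + t\<close> the extra one in \<open>closed_runs\<close> could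
      still balance the equation. Where the number of \<open>False\<close> first passes
      \<open>t\<close>, the next letter is \<open>False\<close> and that term vanishes.\<close>
    then obtain i where i: "i < s + t" "num False i = t" "\<not> letter (Suc i)"
      by (auto elim: num_step_ex)
    then have "num True i \<le> ?x" by (intro num_mono) simp
    then have "num True (num True i) < r" using 2 occ_num_less [OF s, of "num True i"] by linarith
    then show False using closed_runs [of i] i occ_num [OF t] by simp
  qed
qed

lemma num_at_valley:
  assumes s: "occ True r s" and t: "occ False (Suc r) t"
  shows "num True (s + t) = s"
proof (rule ccontr)
  let ?x = "num True (s + t)" and ?y = "num False (s + t)"
  have xy: "?x + ?y = s + t" by (rule num_compl)
  assume "?x \<noteq> s"
  then consider "s < ?x" | "?x < s" by linarith
  then show False
  proof cases
    case 1
    then obtain i where i: "i < s + t" "num True i = s" "letter (Suc i)"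
      by (auto elim: num_step_ex)
    then have "num False i \<le> ?y" by (intro num_mono) simp
    moreover have "?y < t" using 1 xy by linarith
    ultimately have "num False (num False i) < Suc r"
      using occ_num_less [OF t, of "num False i"] by linarith
    then show False using closed_runs [of i] i occ_num [OF s] by simp
  next
    case 2
    then have "num True ?x < r" using occ_num_less [OF s, of ?x] by linarith
    moreover have "Suc r \<le> num False ?y" using occ_num_ge [OF t, of ?y] 2 xy by linarith
    ultimately show False using closed_runs [of "s + t"] by (auto split: if_splits)
  qed
qed

text \<open>This is \<open>f (f r) = f r + g r\<close>, together with the start of the next run:
  \<open>closed_runs\<close> at \<open>s + t\<close> and just before it forces a change from
  \<open>True\<close> to \<open>False\<close>.\<close>

lemma peak:
  assumes s: "occ True r s" and t: "occ False r t"
  shows "occ True s (s + t)" "occ False (Suc t) (Suc (s + t))"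
proof -
  have x: "num True (s + t) = s" by (rule num_at_peak [OF s t])
  then have y: "num False (s + t) = t" using num_compl [of "s + t"] by linarith
  obtain j where j: "s + t = Suc j" using occ_pos [OF s] by (cases "s + t") auto
  have "letter (s + t)"
  proof (rule ccontr)
    assume nw: "\<not> letter (s + t)"
    then have "num True j = s" "num False j = t - 1" using x y j num_Suc [of True j] num_Suc [of False j] by auto
    then show False
      using closed_runs [of j] occ_num [OF s] occ_num_less [OF t, of "t - 1"] occ_pos [OF t] nw j by simp
  qed
  then show "occ True s (s + t)" using x j by (simp add: occ_def)
  have "\<not> letter (Suc (s + t))"
    using closed_runs [of "s + t"] x y occ_num [OF s] occ_num [OF t] by (auto split: if_splits)
  then show "occ False (Suc t) (Suc (s + t))" using y by (simp add: occ_def num_Suc)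
qed

lemma valley:
  assumes s: "occ True r s" and t: "occ False (Suc r) t"
  shows "occ False t (s + t)" "occ True (Suc s) (Suc (s + t))"
proof -
  have x: "num True (s + t) = s" by (rule num_at_valley [OF s t])
  then have y: "num False (s + t) = t" using num_compl [of "s + t"] by linarith
  obtain j where j: "s + t = Suc j" using occ_pos [OF s] by (cases "s + t") auto
  have "\<not> letter (s + t)"
  proof
    assume nw: "letter (s + t)"
    then have "num True j = s - 1" "num False j = t" using x y j num_Suc [of True j] num_Suc [of False j] by auto
    then show False
      using closed_runs [of j] occ_num [OF t] occ_num_less [OF s, of "s - 1"] occ_pos [OF s] nw j by simp
  qed
  then show "occ False t (s + t)" using y j by (simp add: occ_def)
  have "letter (Suc (s + t))"
    using closed_runs [of "s + t"] x y occ_num [OF s] occ_num [OF t] by (auto split: if_splits)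
  then show "occ True (Suc s) (Suc (s + t))" using x by (simp add: occ_def num_Suc)
qed

section \<open>Starts of runs\<close>

definition run :: "bool \<Rightarrow> nat \<Rightarrow> nat \<Rightarrow> bool" where
  "run c b n \<longleftrightarrow> (\<forall>j<n. letter (b + j) = c)"

lemma run_mono: "run c b n \<Longrightarrow> m \<le> n \<Longrightarrow> run c b m"
  by (auto simp: run_def)

lemma occ_along_run:
  assumes "occ c a b" "run (\<not> c) a n" "j \<le> n"
  shows "occ c (a + j) (b + j)"
  using assms(3)
proof (induction j)
  case (Suc j)
  then have o: "occ c (a + j) (b + j)" by simp
  have "letter (a + j) = (\<not> c)" using assms(2) Suc.prems by (auto simp: run_def)
  then have "letter (Suc (b + j)) = c" using occ_next [OF o] by simp
  then show ?case using o by (simp add: occ_def num_Suc)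
qed (use assms in simp)

text \<open>The occurrence at \<open>b\<close> precedes one forced letter for each index of the old
  run, so the image is longer by one. This is why runs keep growing.\<close>

lemma run_image:
  assumes "occ c a b" "run (\<not> c) a n"
  shows "run c b (Suc n)"
  using occ_along_run [OF assms] by (auto simp: run_def occ_def less_Suc_eq_le)

definition run_start :: "bool \<Rightarrow> nat \<Rightarrow> nat \<Rightarrow> bool" where
  "run_start c a b \<longleftrightarrow> occ c a b \<and> 2 \<le> b \<and> letter (b - 1) = (\<not> c)"

lemma run_start_occ: "run_start c a b \<Longrightarrow> occ c a b"
  by (simp add: run_start_def)

lemma run_start_pred:
  assumes "run_start c a b"
  shows "occ (\<not> c) (b - a) (b - 1)" "a < b"
proof -
  obtain b' where b': "b = Suc b'" "b' \<ge> 1" using assms by (cases b) (auto simp: run_start_def)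
  have n: "num c (Suc b') = a" "letter (Suc b') = c" "letter b' = (\<not> c)"
    using assms b' by (auto simp: run_start_def occ_def)
  have "num c b' + num (\<not> c) b' = b'" by (rule num_compl')
  moreover obtain b'' where "b' = Suc b''" using b' by (cases b') auto
  then have "num (\<not> c) b' \<ge> 1" using n by (simp add: num_Suc)
  moreover have "num c b' + 1 = a" using n by (simp add: num_Suc)
  ultimately show "occ (\<not> c) (b - a) (b - 1)" "a < b" using n b' by (auto simp: occ_def)
qed

text \<open>Position \<open>b - 1\<close> holds the opposite letter for the
  \<open>(b - a)\<close>-th time, so \<open>peak\<close> or \<open>valley\<close> applies to it and
  \<open>s\<close>. The extra one for \<open>False\<close> is the shift from \<open>r\<close> to
  \<open>Suc r\<close> in \<open>valley\<close>.\<close>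

lemma run_start_alternate:
  assumes "run_start c a b" "occ c (b - a + of_bool (\<not> c)) s"
  shows "run_start (\<not> c) b (b + s)"
proof (cases c)
  case True
  then have p: "occ False (b - a) (b - 1)" using run_start_pred(1) [OF assms(1)] by simp
  have b: "2 \<le> b" using assms by (simp add: run_start_def)
  show ?thesis
    using peak [of "b - a" s, OF _ p] assms True b by (simp add: run_start_def occ_def add.commute)
next
  case False
  then have p: "occ True (b - a) (b - 1)" using run_start_pred(1) [OF assms(1)] by simp
  have b: "2 \<le> b" using assms by (simp add: run_start_def)
  show ?thesis
    using valley [OF p, of s] assms False b by (simp add: run_start_def occ_def add.commute)
qed

text \<open>The occurrence required by \<open>run_start_alternate\<close> is reached by sliding from
  \<open>q\<close> along the image of the run at \<open>p\<close>; hence the bound on the offset by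
  \<open>n\<close>.\<close>

lemma run_start_step:
  assumes st: "run_start c a b" and r: "run c b m"
    and pq: "occ c p q" "run (\<not> c) p n"
    and b: "b = a + p + d" and d: "d + of_bool (\<not> c) \<le> n"
  shows "run_start (\<not> c) b (b + q + (d + of_bool (\<not> c)))"
    and "run (\<not> c) (b + q + (d + of_bool (\<not> c))) (Suc m)"
proof -
  have "occ c (b - a + of_bool (\<not> c)) (q + (d + of_bool (\<not> c)))"
    using occ_along_run [OF pq d] b by (simp add: algebra_simps)
  from run_start_alternate [OF st this]
  show *: "run_start (\<not> c) b (b + q + (d + of_bool (\<not> c)))" by (simp add: algebra_simps)
  show "run (\<not> c) (b + q + (d + of_bool (\<not> c))) (Suc m)"
    using run_image [OF run_start_occ [OF *], of m] r by simp
qed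

lemma occ_in_run:
  assumes "occ c a b" "run c b n" "j < n"
  shows "occ c (a + j) (b + j)"
  using assms(3)
proof (induction j)
  case (Suc j)
  then have o: "occ c (a + j) (b + j)" by simp
  have "letter (b + Suc j) = c" using assms(2) Suc.prems by (auto simp: run_def)
  then show ?case using o by (simp add: occ_def num_Suc)
qed (use assms in simp)

lemma occ_small: "occ False 1 1" "occ True 1 2" "occ True 2 3" "occ False 2 4" "occ False 3 5"
proof -
  show 1: "occ False 1 1" by (simp add: occ_def num_Suc)
  have "letter 2" using occ_next [OF 1] by (simp add: numeral_2_eq_2)
  then show 2: "occ True 1 2" by (simp add: occ_def num_Suc numeral_2_eq_2)
  have "letter 3" using occ_next [OF 2] by (simp add: numeral_2_eq_2 numeral_3_eq_3)
  then show 3: "occ True 2 3" using 2 by (simp add: occ_def num_Suc numeral_2_eq_2 numeral_3_eq_3)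
  show 4: "occ False 2 4"
    using peak(2) [OF 2 1] by (simp add: eval_nat_numeral)
  show "occ False 3 5"
    using occ_along_run [OF 4, of 1 1] 2 by (simp add: run_def occ_def eval_nat_numeral)
qed

text \<open>The longest runs so far start at the positions \<open>peak_pos l\<close>.\<close>

primrec peak_pos :: "nat \<Rightarrow> nat" where
  "peak_pos 0 = 2"
| "peak_pos (Suc l) = 2 * peak_pos l + (l + 1) div 2"

text \<open>Here \<open>c\<close> is the letter of step 0, and the letters alternate. The growing
  run lengths are recorded because \<open>run_start_step\<close> consumes them.\<close>

definition chain :: "bool \<Rightarrow> nat \<Rightarrow> (nat \<Rightarrow> nat) \<Rightarrow> bool" where
  "chain c n s \<longleftrightarrow>
    (\<forall>l. run_start (c = even l) (s l) (s (Suc l)) \<and> run (c = even l) (s (Suc l)) (l + n))"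

lemma peak_pos_run_start:
  "run (even l) (peak_pos l) (l + 2) \<and> run_start (odd l) (peak_pos l) (peak_pos (Suc l))"
proof (induction l)
  case 0
  have "run True 2 2"
    using occ_small by (auto simp: run_def occ_def less_Suc_eq numeral_2_eq_2 numeral_3_eq_3)
  moreover have "run_start False 2 4"
    using occ_small by (simp add: run_start_def occ_def)
  ultimately show ?case by (simp flip: numeral_2_eq_2)
next
  case (Suc l)
  have r: "run (\<not> odd l) (peak_pos l) (l + 2)" and st: "run_start (odd l) (peak_pos l) (peak_pos (Suc l))"
    using Suc by auto
  have r': "run (odd l) (peak_pos (Suc l)) (l + 3)"
    using run_image [OF run_start_occ [OF st] r] by (simp add: numeral_3_eq_3)
  have d: "(l + 1) div 2 + of_bool (\<not> odd l) = (l + 2) div 2" by (cases "even l") auto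
  show ?case
    \<comment> \<open>The auxiliary pair \<open>p\<close>, \<open>q\<close> is the pair
      \<open>a\<close>, \<open>b\<close> itself, which explains the doubling in
      \<open>peak_pos\<close>.\<close>
    using run_start_step(1) [OF st r' run_start_occ [OF st] r, of "(l + 1) div 2"] r'
    unfolding d by (auto simp: numeral_3_eq_3 algebra_simps)
qed

lemma chain_peak_pos: "chain False 3 peak_pos" "chain True 1 (\<lambda>l. peak_pos (Suc l))"
proof -
  have 1: "run_start (odd l) (peak_pos l) (peak_pos (Suc l))" "run (odd l) (peak_pos (Suc l)) (l + 3)" for l
    using peak_pos_run_start [of l] peak_pos_run_start [of "Suc l"] by (auto simp: numeral_3_eq_3 simp del: peak_pos.simps)
  show "chain False 3 peak_pos" using 1 by (simp add: chain_def del: peak_pos.simps)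
  have "run (even l) (peak_pos (Suc (Suc l))) (l + 1)" for l
    using 1(2) [of "Suc l"] by (auto intro: run_mono simp del: peak_pos.simps)
  then show "chain True 1 (\<lambda>l. peak_pos (Suc l))"
    using 1(1) [of "Suc _"] by (simp add: chain_def del: peak_pos.simps)
qed

text \<open>Each step is \<open>run_start_step\<close> with \<open>p = s (l + 2)\<close> and
  \<open>q = s (l + 3)\<close>. The offset \<open>d\<close> grows by one at every step with letter
  \<open>False\<close>, and the runs of \<open>s\<close> are long enough to absorb it.\<close>

lemma chain_lift:
  assumes s: "chain c n s" and t0: "run_start c (t 0) (t 1)" "run c (t 1) n"
    and t: "\<And>l. t (Suc l) = t l + s (l + 2) + d l"
    and d: "\<And>l. d (Suc l) = d l + of_bool (c \<noteq> even l)" "\<And>l. d (Suc l) \<le> l + 1 + n"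
  shows "chain c n t"
  unfolding chain_def
proof
  fix l
  show "run_start (c = even l) (t l) (t (Suc l)) \<and> run (c = even l) (t (Suc l)) (l + n)"
  proof (induction l)
    case 0
    then show ?case using t0 by simp
  next
    case (Suc l)
    have s': "run_start (c = even (l + 2)) (s (l + 2)) (s (Suc (l + 2)))"
      "run (c = even (Suc l)) (s (Suc (Suc l))) (Suc l + n)"
      using s unfolding chain_def by blast+
    have "occ (c = even l) (s (l + 2)) (s (l + 3))"
      using run_start_occ [OF s'(1)] by (simp add: numeral_3_eq_3)
    moreover have "run (\<not> (c = even l)) (s (l + 2)) (l + 1 + n)"
      using s'(2) by (simp add: numeral_3_eq_3)
    moreover have "d l + of_bool (\<not> (c = even l)) \<le> l + 1 + n"
      using d [of l] by simp
    ultimately have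
      "run_start (\<not> (c = even l)) (t (Suc l)) (t (Suc l) + s (l + 3) + (d l + of_bool (\<not> (c = even l)))) \<and>
       run (\<not> (c = even l)) (t (Suc l) + s (l + 3) + (d l + of_bool (\<not> (c = even l)))) (Suc (l + n))"
      using run_start_step [of "c = even l" "t l" "t (Suc l)" "l + n"] Suc t [of l] by blast
    moreover have "t (Suc l) + s (l + 3) + (d l + of_bool (\<not> (c = even l))) = t (Suc (Suc l))"
      using t [of "Suc l"] d(1) [of l] by (simp add: numeral_3_eq_3)
    ultimately show ?case by simp
  qed
qed

section \<open>Alternating chains of positions\<close>

text \<open>As \<open>center\<close> below shows, \<open>us k (Suc l)\<close> is the position of the \<open>us k l\<close>-th \<open>True\<close> for even \<open>l\<close>
  and of the \<open>us k l\<close>-th \<open>False\<close> for odd \<open>l\<close>; for \<open>vs\<close> the letters are exchanged.\<close>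

fun us :: "nat \<Rightarrow> nat \<Rightarrow> nat" where
  "us 0 l = peak_pos (Suc l)"
| "us (Suc k) 0 = 4 ^ (k + 2)"
| "us (Suc k) (Suc l) = us (Suc k) l + us k (l + 2) + (l + 2) div 2"

fun vs :: "nat \<Rightarrow> nat \<Rightarrow> nat" where
  "vs 0 l = peak_pos l"
| "vs (Suc k) 0 = 4 ^ (k + 2) - 2"
| "vs (Suc k) (Suc l) = vs (Suc k) l + vs k (l + 2) + 2 + (l + 1) div 2"

lemma us_0: "us k 0 = 4 ^ Suc k"
  by (cases k) auto

lemma vs_0: "vs k 0 + 2 = 4 ^ Suc k"
proof (cases k)
  case (Suc j)
  have "(0::nat) < 4 ^ j" by simp
  then have "16 * 4 ^ j - 2 + 2 = (16 * 4 ^ j :: nat)" by linarith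
  then show ?thesis using Suc by simp
qed simp

lemma peak_pos_add: "peak_pos (Suc l) + peak_pos l + l + 2 = 2 ^ (l + 3)"
proof (induction l)
  case (Suc l)
  have "(l + 2) div 2 + (l + 1) div 2 = l + 1" by presburger
  moreover have "peak_pos (Suc (Suc l)) = 2 * peak_pos (Suc l) + (l + 2) div 2" "peak_pos (Suc l) = 2 * peak_pos l + (l + 1) div 2"
    by simp_all
  moreover have "(2::nat) ^ (Suc l + 3) = 2 * 2 ^ (l + 3)" by (simp add: power_add)
  ultimately show ?case using Suc by linarith
qed simp

text \<open>The corrections in the two recursions add up to \<open>l + 3\<close>, which leaves a
  pure power of two. At \<open>l = 1\<close> this locates the next power of four,
  \<open>4 ^ (k + 2)\<close>.\<close>

lemma us_add_vs: "us k l + vs k l + l + 2 = 2 ^ (l + 2 * k + 3)"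
proof (induction k arbitrary: l)
  case 0
  then show ?case using peak_pos_add [of l] by simp
next
  case (Suc k)
  show ?case
  proof (induction l)
    case 0
    have "vs (Suc k) 0 + 2 = 4 ^ (k + 2)" "us (Suc k) 0 = 4 ^ (k + 2)" 
      using vs_0 [of "Suc k"] by auto
    then have "us (Suc k) 0 + vs (Suc k) 0 + 2 = 2 * 4 ^ (k + 2)" by linarith
    also have "\<dots> = 2 ^ (2 * Suc k + 3)" by (simp add: power_mult power_add)
    finally show ?case by simp
  next
    case IH: (Suc l)
    have "(l + 2) div 2 + (l + 1) div 2 = l + 1" by presburger
    moreover have "us k (l + 2) + vs k (l + 2) + (l + 2) + 2 = 2 ^ (l + 2 + 2 * k + 3)" by (rule Suc.IH)
    moreover have "(2::nat) ^ (Suc l + 2 * Suc k + 3) = 2 ^ (l + 2 * Suc k + 3) + 2 ^ (l + 2 + 2 * k + 3)"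
      by (simp add: power_add)
    ultimately show ?case using IH by simp
  qed
qed

text \<open>With \<open>m = 4 ^ Suc k\<close>, the last conjunct puts the \<open>(m - 1)\<close>-th
  \<open>True\<close> two positions before the \<open>m\<close>-th; it feeds \<open>valley\<close>
  in the induction.\<close>

definition center :: "nat \<Rightarrow> bool" where
  "center k \<longleftrightarrow> chain True 1 (us k) \<and> chain False 3 (vs k) \<and>
    occ True (4 ^ Suc k - 1) (us k 1 - 2)"

lemma center: "center k"
proof (induction k)
  case 0
  have "occ True 3 7" using peak(1) [OF occ_small(3,4)] by simp
  moreover have "us 0 = (\<lambda>l. peak_pos (Suc l))" "vs 0 = peak_pos" by auto
  ultimately show ?case using chain_peak_pos by (simp add: center_def)
next
  case (Suc k)
  \<comment> \<open>In terms of \<open>f\<close> and \<open>g\<close>: \<open>U = f m\<close> and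
    \<open>V = g (m - 2)\<close>; \<open>N\<close> will turn out to be
    \<open>U + V + 3\<close>.\<close>
  define m N U V where "m = (4::nat) ^ Suc k" and "N = 4 * m" and "U = us k 1" and "V = vs k 1"
  define U' V' where "U' = us k 2" and "V' = vs k 2"
  have m: "m \<ge> 4" by (simp add: m_def)
  have cu: "chain True 1 (us k)" and cv: "chain False 3 (vs k)" and m1: "occ True (m - 1) (U - 2)"
    using Suc by (auto simp: center_def m_def U_def)
  have start: "us k 0 = m" "vs k 0 = m - 2" "us (Suc k) 0 = N" "vs (Suc k) 0 = N - 2"
    using us_0 [of k] vs_0 [of k] us_0 [of "Suc k"] vs_0 [of "Suc k"] by (auto simp: m_def N_def)
  have u: "run_start True m U" "run_start False U U'"
    using cu start unfolding chain_def U_def U'_def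
    by (auto dest: spec [of _ 0] spec [of _ 1] simp: numeral_2_eq_2)
  have v: "run_start False (m - 2) V" "run False V 3" "run_start True V V'"
    using cv start unfolding chain_def V_def V'_def
    by (auto dest: spec [of _ 0] spec [of _ 1] simp: numeral_2_eq_2)
  have "U + V + 3 = 2 ^ (1 + 2 * k + 3)"
    using us_add_vs [of k 1] unfolding U_def V_def by simp
  then have N: "N = U + V + 3"
    by (simp add: N_def m_def power_add power_mult)
  have om: "occ False m (V + 2)"
    using occ_in_run [OF run_start_occ [OF v(1)] v(2), of 2] m by (simp del: add_2_eq_Suc')
  have N1: "occ True U (U + V + 2)"
    using peak [OF run_start_occ [OF u(1)] om] by (auto simp: occ_def N numeral_3_eq_3)
  have U: "U \<ge> 3" using occ_pos [OF m1] by simp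
  \<comment> \<open>Together with \<open>N1\<close>, positions \<open>N - 3\<close>,
    \<open>N - 2\<close>, \<open>N - 1\<close> carry \<open>False\<close>, \<open>True\<close>,
    \<open>True\<close>. This local pattern starts both new chains.\<close>
  have "occ True (U - 1) (U + V + 1)" "occ False (V + 2) (U + V)"
  proof -
    obtain U2 where "U = U2 + 2" using U by (intro that [of "U - 2"]) simp
    then show "occ True (U - 1) (U + V + 1)" "occ False (V + 2) (U + V)"
      using valley [OF m1, of "V + 2"] om m by auto
  qed
  then have N2: "letter (U + V + 1)" and N3: "occ False (V + 2) (U + V)"
    by (auto simp: occ_def)
  have ou: "occ False (U + 1) (U' + 1)"
    using occ_along_run [OF run_start_occ [OF u(2)], of 1 1] occ_letter [OF run_start_occ [OF u(1)]]
    by (simp add: run_def)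
  have U1: "us (Suc k) 1 = U + V + U' + 4" using start N by (simp add: U'_def numeral_2_eq_2)
  have st: "run_start True N (us (Suc k) 1)"
    using valley [OF N1, of "U' + 1"] ou unfolding U1
    by (auto simp: run_start_def occ_def N eval_nat_numeral)
  have "run True (us (Suc k) 1) 1"
    using st by (auto simp: run_def run_start_def occ_def)
  then have "chain True 1 (us (Suc k))"
    using start st by (intro chain_lift [OF cu, where d = "\<lambda>l. (l + 2) div 2"]) auto
  moreover have "occ True (N - 1) (us (Suc k) 1 - 2)"
    using peak(1) [OF N1 run_start_occ [OF u(2)]] unfolding U1 by (simp add: N algebra_simps)
  moreover have "chain False 3 (vs (Suc k))"
  proof -
    have ov: "occ True (V + 2) (V' + 2)"
      using occ_along_run [OF run_start_occ [OF v(3)], of 3 2] v(2) by simp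
    have V1: "vs (Suc k) 1 = U + V + V' + 3" using start N by (simp add: V'_def numeral_2_eq_2)
    have st: "run_start False (N - 2) (vs (Suc k) 1)"
      using peak [OF ov N3] unfolding V1
      by (auto simp: run_start_def occ_def N eval_nat_numeral algebra_simps)
    have "run True (N - 2) 2"
      using N2 occ_letter [OF N1] by (auto simp: run_def less_Suc_eq numeral_2_eq_2 N)
    then have "run False (vs (Suc k) 1) 3"
      using run_image [OF run_start_occ [OF st], of 2] by (simp add: numeral_3_eq_3)
    then show ?thesis
      using start st by (intro chain_lift [OF cv, where d = "\<lambda>l. 2 + (l + 1) div 2"]) auto
  qed
  moreover have "4 ^ Suc (Suc k) = N" by (simp add: N_def m_def)
  ultimately show ?case by (simp add: center_def)
qed

section \<open>Times of the increments\<close>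

lemma peak_pos_less_Suc: "peak_pos l < peak_pos (Suc l)"
  using run_start_pred(2) peak_pos_run_start by blast

lemma peak_pos_strict_mono: "l < m \<Longrightarrow> peak_pos l < peak_pos m"
  by (rule lift_Suc_mono_less [of peak_pos]) (use peak_pos_less_Suc in auto)

lemma peak_pos_mono: "l \<le> m \<Longrightarrow> peak_pos l \<le> peak_pos m"
  using peak_pos_strict_mono by (cases "l = m") (auto simp: order_le_less)

lemma peak_pos_ge: "l + 2 \<le> peak_pos l"
  by (induction l) auto

lemma letter_peak_pos: "letter (peak_pos l) = even l"
  using peak_pos_run_start [of l] by (auto simp: run_def dest: spec [of _ 0])

definition level :: "nat \<Rightarrow> nat" where
  "level i = (LEAST l. i < peak_pos l)"

lemma less_peak_pos_level: "i < peak_pos (level i)"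
  unfolding level_def by (rule LeastI [of _ i]) (use peak_pos_ge [of i] in linarith)

lemma level_le_iff: "level i \<le> l \<longleftrightarrow> i < peak_pos l"
  using less_peak_pos_level [of i] peak_pos_mono [of "level i" l] Least_le [of "\<lambda>l. i < peak_pos l" l]
  by (auto simp: level_def)

lemma less_level_iff: "l < level i \<longleftrightarrow> peak_pos l \<le> i"
  using level_le_iff [of i l] by linarith

text \<open>Two increments are about two indices apart, and each peak of the word pulls the later
  increments one index ahead. The correction to the next number of the right parity accounts for
  the fact that \<open>True\<close> can only occur at odd and \<open>False\<close> only at even indices.\<close>

definition delay :: "nat \<Rightarrow> nat" where
  "delay i = level i + of_bool (even (level i) = letter i)"

lemma even_delay: "even (delay i) \<longleftrightarrow> \<not> letter i"
  by (auto simp: delay_def)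

lemma level_le_delay: "level i \<le> delay i" and delay_le: "delay i \<le> Suc (level i)"
  by (auto simp: delay_def)

text \<open>The level rises only on reaching some \<open>peak_pos l\<close>, and the letter there
  has the parity for which the delay is not rounded up.\<close>

lemma delay_Suc: "delay (Suc i) = level i \<or> delay (Suc i) = Suc (level i)"
proof (cases "level (Suc i) = level i")
  case True
  then show ?thesis by (auto simp: delay_def)
next
  case False
  have "level i \<le> level (Suc i)" using less_peak_pos_level [of "Suc i"] by (simp add: level_le_iff)
  with False have "peak_pos (level i) \<le> Suc i" using less_level_iff [of "level i" "Suc i"] by simp
  then have i: "Suc i = peak_pos (level i)" using less_peak_pos_level [of i] by simp
  then have "level (Suc i) \<le> Suc (level i)" using peak_pos_less_Suc by (simp add: level_le_iff del: peak_pos.simps)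
  with False \<open>level i \<le> level (Suc i)\<close> have "level (Suc i) = Suc (level i)" by simp
  then show ?thesis using i letter_peak_pos [of "level i"] by (simp add: delay_def)
qed

text \<open>The \<open>i\<close>-th increment of the sequence along its odd or even indices happens at index \<open>time i\<close>;
  the letter \<open>letter i\<close> tells whether this index is odd.\<close>

definition time :: "nat \<Rightarrow> int" where
  "time i = 2 * int i + 2 - int (delay i)"

lemma even_time: "even (time i) \<longleftrightarrow> \<not> letter i"
  by (simp add: time_def even_delay)

lemma time_Suc: "time i < time (Suc i)" "time (Suc i) \<le> time i + 3"
  using delay_Suc [of i] level_le_delay [of i] delay_le [of i] by (auto simp: time_def)

lemma time_strict_mono: "i < j \<Longrightarrow> time i < time j"
  by (rule lift_Suc_mono_less [of time]) (use time_Suc in auto)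

lemma time_mono: "i \<le> j \<Longrightarrow> time i \<le> time j"
  using time_strict_mono by (cases "i = j") (auto simp: order_le_less)

lemma time_less_iff: "time i < time j \<longleftrightarrow> i < j"
  using time_strict_mono [of i j] time_mono [of j i] by linarith

lemma level_0 [simp]: "level 0 = 0" and level_1 [simp]: "level (Suc 0) = 0"
  using level_le_iff [of 0 0] level_le_iff [of "Suc 0" 0] by auto

lemma time_0 [simp]: "time 0 = 2" and time_1 [simp]: "time (Suc 0) = 4"
  by (simp_all add: time_def delay_def)

lemma time_2: "time 2 = 5"
proof -
  have "level 2 = 1" using level_le_iff [of 2 0] level_le_iff [of 2 1] by simp
  moreover have "letter 2" using occ_small by (simp add: occ_def)
  ultimately show ?thesis by (simp add: time_def delay_def)
qed

lemma time_ge: "int i + 2 \<le> time i"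
proof (induction i)
  case (Suc i)
  then show ?case using time_Suc(1) [of i] by simp
qed simp

text \<open>The number of increments at indices up to \<open>n\<close>. Since
  \<open>time 0 = 2\<close> belongs to no increment, the search looks at
  \<open>Suc i\<close>.\<close>

definition incs :: "nat \<Rightarrow> nat" where
  "incs n = (LEAST i. int n < time (Suc i))"

lemma less_time_incs: "int n < time (Suc (incs n))"
  unfolding incs_def by (rule LeastI [of _ n]) (use time_ge [of "Suc n"] in linarith)

lemma le_incs_iff:
  assumes "1 \<le> i"
  shows "i \<le> incs n \<longleftrightarrow> time i \<le> int n"
proof
  assume "i \<le> incs n"
  then have "i - 1 < incs n" using assms by simp
  then have "\<not> int n < time (Suc (i - 1))"
    unfolding incs_def by (rule not_less_Least)
  then show "time i \<le> int n" using assms by simp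
next
  assume "time i \<le> int n"
  then have "time i < time (Suc (incs n))" using less_time_incs [of n] by linarith
  then show "i \<le> incs n" by (simp add: time_less_iff)
qed

lemma time_incs_le: "2 \<le> n \<Longrightarrow> time (incs n) \<le> int n"
  using le_incs_iff [of "incs n" n] by (cases "incs n") auto

lemma incs_eqI:
  assumes "time i \<le> int n" "int n < time (Suc i)"
  shows "incs n = i"
proof (rule antisym)
  show "incs n \<le> i"
    using le_incs_iff [of "Suc i" n] assms by simp
  show "i \<le> incs n"
    using le_incs_iff [of i n] assms by (cases i) auto
qed

text \<open>Describing the count by times lets parity decide which increments are visible.\<close>

lemma num_incs:
  "num c (incs n) = card {i. 1 \<le> i \<and> letter i = c \<and> time i \<le> int n}"
  unfolding num_def by (rule arg_cong [of _ _ card]) (auto simp: le_incs_iff)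

text \<open>No increment with letter \<open>odd n\<close> occurs at \<open>n + 1\<close>, for parity
  reasons. So \<open>z\<close> may miss the true count slightly, and only the visibility of the
  \<open>z\<close>-th increment itself must be decided.\<close>

lemma num_incs_eq:
  assumes par: "c = odd n" and up: "int n < time (Suc z)" 
    and down: "\<And>z'. z = Suc z' \<Longrightarrow> time z' \<le> int n + 1"
  shows "num c (incs n) = num c z - of_bool (1 \<le> z \<and> letter z = c \<and> int n + 1 < time z)"
proof -
  have *: "time i \<le> int n" if "letter i = c" "time i \<le> int n + 1" for i
  proof -
    have "even (time i) \<longleftrightarrow> even (int n)" using that par by (simp add: even_time)
    then have "time i \<noteq> int n + 1" by auto
    with that show ?thesis by simp
  qed
  have below: "time i \<le> int n" if "i < z" "letter i = c" for i
    using * [OF that(2)] down [of "z - 1"] that(1) time_mono [of i "z - 1"] by force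
  have above: "i \<le> z" if "time i \<le> int n" for i
    using that up time_less_iff [of i "Suc z"] by linarith
  show ?thesis
  proof (cases "1 \<le> z \<and> letter z = c \<and> int n + 1 < time z")
    case True
    then obtain z' where z: "z = Suc z'" by (cases z) auto
    have "time i \<le> int n \<longleftrightarrow> i \<le> z'" if "letter i = c" for i
      using above [of i] below [of i] that True z by (cases "i = z") auto
    then have "{i. 1 \<le> i \<and> letter i = c \<and> time i \<le> int n} = {j \<in> {1..z'}. letter j = c}" by auto
    then have "num c (incs n) = num c z'" unfolding num_incs by (simp add: num_def)
    then show ?thesis using True z by (simp add: num_Suc)
  next
    case False
    have "time i \<le> int n \<longleftrightarrow> i \<le> z" if "letter i = c" "1 \<le> i" for i
      using above [of i] below [of i] * [of i] that False by (cases "i = z") auto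
    then have "{i. 1 \<le> i \<and> letter i = c \<and> time i \<le> int n} = {j \<in> {1..z}. letter j = c}" by auto
    then have "num c (incs n) = num c z" unfolding num_incs by (simp add: num_def)
    then show ?thesis using False by (auto simp: of_bool_def)
  qed
qed

lemma num_incs_compl:
  assumes "2 \<le> n" "c \<noteq> odd n"
  shows "num c (incs (n - 1)) = num c (incs n)"
proof -
  have "time i \<le> int (n - 1) \<longleftrightarrow> time i \<le> int n" if "letter i = c" for i
  proof -
    have "even (time i) \<noteq> even (int n)" using that assms by (simp add: even_time)
    then have "time i \<noteq> int n" by auto
    then show ?thesis using assms by auto
  qed
  then show ?thesis unfolding num_incs by (metis (mono_tags, lifting))
qed

text \<open>The recursion for \<open>Qt\<close> in terms of the word: each new position advances
  exactly one of the two inner counts, to an index whose letter is the negation of the next letter.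
  The last term stems from the initial \<open>False\<close>.\<close>

lemma num_law:
  "num c (Suc j) = num (\<not> c) (num True j) + num (\<not> c) (num False j) + of_bool (\<not> c)"
proof (induction j)
  case 0
  then show ?case by (simp add: num_Suc)
next
  case (Suc j)
  have "letter (Suc (Suc j)) = (\<not> letter (num (letter (Suc j)) (Suc j)))"
    by (rule letter_Suc) simp
  moreover have "num (\<not> c) (num True (Suc j)) + num (\<not> c) (num False (Suc j)) =
      num (\<not> c) (num True j) + num (\<not> c) (num False j) + of_bool (letter (num (letter (Suc j)) (Suc j)) \<noteq> c)"
    by (cases "letter (Suc j)") (simp_all add: num_Suc)
  ultimately show ?case
    using Suc num_Suc [of c "Suc j"] by auto
qed

text \<open>Since \<open>peak_pos\<close> roughly doubles, passing from \<open>j\<close> to the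
  number of either letter up to \<open>j\<close> lowers the level by about one.\<close>

lemma counts_bounds:
  assumes j: "2 \<le> j" and z: "z = num c j"
  shows "level j \<le> Suc (delay z)" "delay z \<le> level j" "delay (Suc z) \<le> level j" "1 \<le> z" "level j \<le> delay (z - 1) + 2"
proof -
  have "0 < level j" using j less_level_iff [of 0 j] by simp
  then obtain l where l: "level j = Suc l" by (cases "level j") auto
  have lo: "peak_pos l \<le> j" using l less_level_iff [of l j] by simp
  have hi: "j < peak_pos (Suc l)" using less_peak_pos_level [of j] l by simp
  have st: "run_start (odd l) (peak_pos l) (peak_pos (Suc l))" and run: "run (even l) (peak_pos l) (l + 2)"
    using peak_pos_run_start by auto
  show z1: "1 \<le> z"
  proof -
    have "1 \<le> num True 2" "1 \<le> num False 2"
      using occ_num_ge [OF occ_small(1), of 2] occ_num_ge [OF occ_small(2), of 2] by auto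
    then show ?thesis using num_mono [OF j, of c] z by (cases c) auto
  qed
  have up: "z \<le> peak_pos l + (l + 1) div 2"
  proof -
    have "num (odd l) j < peak_pos l" by (rule occ_num_less [OF run_start_occ [OF st] hi])
    moreover have "num (even l) j \<le> peak_pos (Suc l) - peak_pos l"
      using num_mono [of j "peak_pos (Suc l) - 1" "even l"] hi occ_num [OF run_start_pred(1) [OF st]] by simp
    ultimately show ?thesis using z by (cases "c = even l") auto
  qed
  \<comment> \<open>Just beyond \<open>peak_pos l\<close> the level is already \<open>Suc l\<close>,
    but the run there has the letter \<open>even l\<close>, so the delay is not rounded up.\<close>
  have bnd: "delay i \<le> Suc l" if "i \<le> Suc (peak_pos l + (l + 1) div 2)" for i
  proof (cases "i < peak_pos l")
    case True
    then show ?thesis using delay_le [of i] level_le_iff [of i l] by simp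
  next
    case False
    then obtain d where d: "i = peak_pos l + d" using le_Suc_ex by (metis not_less)
    then have "d < l + 2" using that by auto
    then have "letter i = even l" using run d by (auto simp: run_def)
    moreover have "level i = Suc l"
    proof (rule antisym)
      show "level i \<le> Suc l" using that peak_pos_ge [of l] by (simp add: level_le_iff)
      show "Suc l \<le> level i" using False less_level_iff [of l i] by simp
    qed
    ultimately show ?thesis by (simp add: delay_def)
  qed
  show "delay z \<le> level j" "delay (Suc z) \<le> level j" using up bnd l by auto
  have low: "peak_pos (l - 1) \<le> z" if "1 \<le> l"
  proof -
    obtain m where m: "l = Suc m" using \<open>1 \<le> l\<close> by (cases l) auto
    have st: "run_start (odd m) (peak_pos m) (peak_pos l)" using peak_pos_run_start [of m] m by simp
    have "peak_pos m \<le> num (odd m) j" by (rule occ_num_ge [OF run_start_occ [OF st] lo])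
    moreover have "peak_pos l - peak_pos m \<le> num (even m) j"
      using occ_num_ge [OF run_start_pred(1) [OF st], of j] lo by simp
    ultimately show ?thesis using z m by (cases "c = even m") auto
  qed
  show "level j \<le> Suc (delay z)"
  proof (cases "l = 0")
    case False
    then have "l - 1 < level z" using low less_level_iff by simp
    then show ?thesis using level_le_delay [of z] l by simp
  qed (use l in simp)
  show "level j \<le> delay (z - 1) + 2"
  proof (cases "l \<le> 1")
    case False
    then have "peak_pos (l - 2) < peak_pos (l - 1)" by (intro peak_pos_strict_mono) simp
    then have "l - 2 < level (z - 1)" using low False less_level_iff by auto
    then show ?thesis using level_le_delay [of "z - 1"] l False by simp
  qed (use l in simp)
qed

text \<open>The last occurrence of the other letter closed its run, and a run closes exactly at an
  occurrence whose number carries the same letter.\<close>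

lemma letter_num_other:
  assumes "1 \<le> num (\<not> letter j) j"
  shows "letter (num (\<not> letter j) j) = (\<not> letter j)"
  using assms
proof (induction j)
  case (Suc j)
  show ?case
  proof (cases "letter (Suc j) = letter j")
    case True
    then show ?thesis using Suc by (simp add: num_Suc)
  next
    case False
    then have "1 \<le> j" by (cases j) auto
    moreover have "num (\<not> letter (Suc j)) (Suc j) = num (letter j) j"
      using False by (auto simp: num_Suc)
    ultimately show ?thesis using letter_Suc [of j] by simp
  qed
qed simp

text \<open>In the recursion for \<open>Qt n\<close> the two arguments are, up to the delay, the times of the
  increments with numbers \<open>num True j\<close> and \<open>num False j\<close>, so \<open>num_law\<close> applies unless one of these two
  increments is not yet visible; in that case the \<open>Suc j\<close>-th increment occurs later than \<open>n\<close>.\<close>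

lemma increment_law:
  assumes n: "3 \<le> n"
  defines "j \<equiv> incs (n - 1)"
  defines "N \<equiv> \<lambda>d. n - 1 - 2 * num (\<not> d) j"
  shows "2 * num d j + 2 \<le> n"
    and "num (odd n) (incs n) = num (even n) (incs (N True)) + num (even n) (incs (N False)) + of_bool (even n)"
proof -
  have lo: "time j \<le> int n - 1" using time_incs_le [of "n - 1"] n by (simp add: j_def of_nat_diff)
  have hi: "int n - 1 < time (Suc j)" using less_time_incs [of "n - 1"] n by (simp add: j_def of_nat_diff)
  \<comment> \<open>The time elapsed at \<open>n - 1\<close> since \<open>time j\<close>;
    consecutive times differ by at most 3, so \<open>r\<close> is at most 2.\<close>
  define r where "r = int n - 1 - time j"
  have r: "0 \<le> r" "r \<le> 2" using lo hi time_Suc(2) [of j] by (auto simp: r_def)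
  have r2: "delay j = Suc (level j)" if "r = 2"
    using that hi delay_Suc [of j] delay_le [of j] level_le_delay [of j] by (auto simp: r_def time_def)
  have small: "delay j = 0" "level j = 0" "r \<le> 1 - int j" if "j < 2"
  proof -
    have "j = 0 \<or> j = Suc 0" using that by auto
    then show "delay j = 0" "level j = 0" "r \<le> 1 - int j"
      using hi time_2 by (auto simp: delay_def r_def numeral_2_eq_2)
  qed
  have key: "2 * num (\<not> d) j + 2 \<le> n \<and>
    num (even n) (incs (N d)) = num (even n) (num d j) -
      of_bool (1 \<le> num d j \<and> r = 0 \<and> delay j = Suc (level j) \<and> letter (num d j) = letter j) \<and>
    (1 \<le> num d j \<and> r = 0 \<and> delay j = Suc (level j) \<and> letter (num d j) = letter j
      \<longrightarrow> 1 \<le> num (even n) (num d j))" for d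
  proof -
    define z where "z = num d j"
    have zj: "z + num (\<not> d) j = j" unfolding z_def by (rule num_compl')
    have Nz: "int n - 1 - 2 * int (num (\<not> d) j) = 2 * int z + 2 - int (delay j) + r"
      using zj by (simp add: r_def time_def)
    have down: "time z' \<le> 2 * int z + 2 - int (delay j) + r + 1" if "z = Suc z'" for z'
    proof (cases "j < 2")
      case True
      then show ?thesis using that small r time_mono [of z' z] by (simp add: time_def)
    next
      case False
      then have "level j \<le> delay z' + 2" using counts_bounds(5) [of j z d] that z_def by simp
      then show ?thesis using that delay_le [of j] r by (simp add: time_def)
    qed
    have up: "2 * int z + 2 - int (delay j) + r < time (Suc z)"
    proof (cases "j < 2")
      case True
      then consider "z = 0" | "z = Suc 0" "j = 1" using zj by linarith
      then show ?thesis using small [OF True] time_2 by cases (auto simp: numeral_2_eq_2)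
    next
      case False
      then have "delay (Suc z) \<le> level j" using counts_bounds(3) [of j z d] z_def by simp
      then show ?thesis using level_le_delay [of j] r r2 by (cases "r = 2") (auto simp: time_def)
    qed
    have pos: "1 \<le> 2 * int z + 2 - int (delay j) + r"
    proof (cases z)
      case 0
      then have "j < 2" using counts_bounds(4) [of j z d] z_def by linarith
      then show ?thesis using 0 small r by simp
    next
      case (Suc z')
      then show ?thesis using down [OF Suc] time_mono [of 0 z'] by simp
    qed
    then have le: "2 * num (\<not> d) j + 2 \<le> n" using Nz by linarith
    then have N: "int (N d) = 2 * int z + 2 - int (delay j) + r" "even (N d) \<longleftrightarrow> odd n"
      using Nz by (auto simp: N_def)
    \<comment> \<open>This decides when the \<open>z\<close>-th increment is still invisible at
      \<open>N d\<close>: only right at an increment with rounded-up delay.\<close>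
    have loss: "1 \<le> z \<and> letter z = even n \<and> int (N d) + 1 < time z \<longleftrightarrow>
        1 \<le> z \<and> r = 0 \<and> delay j = Suc (level j) \<and> letter z = letter j"
    proof (cases "j < 2")
      case True
      then show ?thesis using small r N by (auto simp: time_def)
    next
      case False
      then have b: "level j \<le> Suc (delay z)" "delay z \<le> level j" using counts_bounds(1,2) [of j z d] z_def by auto
      have par: "even (int n - 1 - r) \<longleftrightarrow> \<not> letter j" using even_time [of j] by (simp add: r_def)
      have "int (N d) + 1 < time z \<longleftrightarrow> int (delay z) + 1 + r < int (delay j)" using N by (auto simp: time_def)
      also have "\<dots> \<longleftrightarrow> r = 0 \<and> delay j = Suc (level j) \<and> Suc (delay z) = level j"
        using b delay_le [of j] r by auto
      also have "\<dots> \<longleftrightarrow> r = 0 \<and> delay j = Suc (level j) \<and> letter z = letter j"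
      proof -
        have "Suc (delay z) = level j \<longleftrightarrow> letter z = letter j" if "delay j = Suc (level j)"
        proof -
          consider "delay z = level j" | "level j = Suc (delay z)" using b by linarith
          then have "Suc (delay z) = level j \<longleftrightarrow> even (delay z) = even (delay j)"
            by cases (auto simp: that)
          then show ?thesis by (auto simp: even_delay)
        qed
        then show ?thesis by auto
      qed
      finally show ?thesis using par by auto
    qed
    have "num (even n) (incs (N d)) = num (even n) z - of_bool (1 \<le> z \<and> letter z = even n \<and> int (N d) + 1 < time z)"
      by (rule num_incs_eq) (use N up down in auto)
    moreover have "1 \<le> num (even n) z" if "1 \<le> z \<and> letter z = even n"
      using that by (cases z) (auto simp: num_Suc)
    ultimately show ?thesis using le loss unfolding z_def by simp blast
  qed
  show "2 * num d j + 2 \<le> n" using key [of "\<not> d"] by simp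
  define loss where "loss = (\<lambda>d. 1 \<le> num d j \<and> r = 0 \<and> delay j = Suc (level j) \<and> letter (num d j) = letter j)"
  have *: "num (even n) (incs (N d)) + of_bool (loss d) = num (even n) (num d j)" for d
    using key [of d] unfolding loss_def by auto
  \<comment> \<open>Only the summand for \<open>letter j\<close> can lose an increment, so the total
    loss is at most one.\<close>
  have other: "\<not> loss (\<not> letter j)" using letter_num_other [of j] by (auto simp: loss_def)
  have same: "loss (letter j) \<longleftrightarrow> r = 0 \<and> delay j = Suc (level j) \<and> letter (Suc j) \<noteq> letter j"
  proof (cases "j = 0")
    case True
    then show ?thesis by (simp add: loss_def delay_def)
  next
    case False
    then have "1 \<le> num (letter j) j" by (cases j) (auto simp: num_Suc)
    then show ?thesis using False letter_Suc [of j] by (auto simp: loss_def)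
  qed
  have "num (odd n) (Suc j) = num (even n) (num True j) + num (even n) (num False j) + of_bool (even n)"
    using num_law [of "odd n" j] by simp
  then have total: "num (odd n) (Suc j) =
      num (even n) (incs (N True)) + num (even n) (incs (N False)) + of_bool (even n) + of_bool (loss (letter j))"
    using * [of True] * [of False] other by (cases "letter j") auto
  have par: "even (int n - 1 - r) \<longleftrightarrow> \<not> letter j" using even_time [of j] by (simp add: r_def)
  have par': "even (time (Suc j)) \<longleftrightarrow> \<not> letter (Suc j)" by (rule even_time)
  have thS: "delay (Suc j) = level j \<or> delay (Suc j) = Suc (level j)" by (rule delay_Suc)
  have tmS: "time (Suc j) = int n + 1 - r + int (delay j) - int (delay (Suc j))"
    by (simp add: r_def time_def)
  show "num (odd n) (incs n) = num (even n) (incs (N True)) + num (even n) (incs (N False)) + of_bool (even n)"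
  proof (cases "time (Suc j) \<le> int n")
    case True
    then have eq: "time (Suc j) = int n" using hi by simp
    then have "incs n = Suc j" using time_Suc(1) [of "Suc j"] by (intro incs_eqI) auto
    moreover have "\<not> loss (letter j)"
      using eq tmS thS by (auto simp: same)
    ultimately show ?thesis using total by simp
  next
    case False
    then have "incs n = j" using lo by (intro incs_eqI) auto
    \<comment> \<open>The loss compensates exactly for the increment that \<open>num_law\<close>
      counts at \<open>Suc j\<close> but that has not happened by \<open>n\<close>.\<close>
    moreover have "loss (letter j) \<longleftrightarrow> letter (Suc j) = odd n"
    proof -
      have "delay j = level j \<or> delay j = Suc (level j)" using delay_le [of j] level_le_delay [of j] by auto
      moreover have "r = 0 \<or> r = 1 \<or> r = 2" using r by auto
      ultimately show ?thesis
        using False tmS thS par par' by (auto simp: same)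
    qed
    moreover have "num (odd n) (Suc j) = num (odd n) j + of_bool (letter (Suc j) = odd n)"
      by (simp add: num_Suc)
    ultimately show ?thesis using total by simp
  qed
qed

text \<open>Strong induction: \<open>increment_law\<close> is the recursion after substituting the
  claim, and its first part shows that the guard holds.\<close>

lemma Qt_eq: "1 \<le> n \<Longrightarrow> Qt n = 2 * int (num (odd n) (incs n)) + 1"
proof (induction n rule: less_induct)
  case (less n)
  have incs0: "incs n = 0" if "n < 4" for n
    using le_incs_iff [of 1 n] that by simp
  show ?case
  proof (cases "n \<le> 2")
    case True
    then have "Qt n = 1" using less.prems by (subst Qt.simps) simp
    then show ?thesis using True incs0 [of n] by simp
  next
    case False
    define j where "j = incs (n - 1)"
    have le: "2 * num d j + 2 \<le> n" for d
      using increment_law(1) [of n d] False by (simp add: j_def)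
    have Q1: "Qt (n - 1) = 2 * int (num (even n) j) + 1"
      using less.IH [of "n - 1"] False by (simp add: j_def)
    \<comment> \<open>Index \<open>n - 1\<close> has the wrong parity for the letter
      \<open>odd n\<close>, so both preceding terms can be read off from the same
      \<open>j\<close>.\<close>
    have "num (odd n) (incs (n - 2)) = num (odd n) j"
      using num_incs_compl [of "n - 1" "odd n"] False by (simp add: j_def numeral_2_eq_2 [symmetric])
    then have Q2: "Qt (n - 2) = 2 * int (num (odd n) j) + 1"
      using less.IH [of "n - 2"] False by simp
    have Q: "Qt (n - 1 - 2 * num d j) = 2 * int (num (even n) (incs (n - 1 - 2 * num d j))) + 1" for d
      using less.IH [of "n - 1 - 2 * num d j"] le [of d] False by simp
    have arg: "nat (int n - (2 * int (num d j) + 1)) = n - 1 - 2 * num d j" for d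
      using le [of d] by linarith
    have "Qt n = Qt (nat (int n - Qt (n - 1))) + Qt (nat (int n - Qt (n - 2))) + (-1) ^ n"
    proof -
      have "1 \<le> Qt (n - 1) \<and> Qt (n - 1) < int n \<and> 1 \<le> Qt (n - 2) \<and> Qt (n - 2) < int n"
        using le [of "even n"] le [of "odd n"] unfolding Q1 Q2 by linarith
      then show ?thesis using False by (subst Qt.simps) simp
    qed
    also have "\<dots> = Qt (n - 1 - 2 * num True j) + Qt (n - 1 - 2 * num False j) + (-1) ^ n"
      unfolding Q1 Q2 arg by (cases "even n") auto
    also have "\<dots> = 2 * int (num (odd n) (incs n)) + 1"
      using increment_law(2) [of n] Q [of True] Q [of False] False unfolding j_def
      by (cases "even n") auto
    finally show ?thesis .
  qed
qed

section \<open>Central binomial coefficients\<close>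

definition lower_sum :: "nat \<Rightarrow> nat \<Rightarrow> nat" where
  "lower_sum n m = (\<Sum>i\<le>m. n choose i)"

lemma lower_sum_Suc: "lower_sum (Suc n) (Suc m) = lower_sum n (Suc m) + lower_sum n m"
proof -
  have "lower_sum (Suc n) (Suc m) = 1 + (\<Sum>i\<le>m. (n choose i) + (n choose Suc i))"
    unfolding lower_sum_def by (subst sum.atMost_Suc_shift) simp
  also have "\<dots> = (1 + (\<Sum>i\<le>m. n choose Suc i)) + (\<Sum>i\<le>m. n choose i)"
    by (simp add: sum.distrib)
  also have "1 + (\<Sum>i\<le>m. n choose Suc i) = lower_sum n (Suc m)"
    unfolding lower_sum_def by (subst sum.atMost_Suc_shift) simp
  finally show ?thesis by (simp add: lower_sum_def)
qed

lemma lower_sum_half: "lower_sum (2 * m + 1) m = 4 ^ m"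
  unfolding lower_sum_def using binomial_r_part_sum [of m] by (simp add: power_mult)

text \<open>The lower half of row \<open>2 * m + 3\<close> sums to \<open>4 ^ (m + 1)\<close>;
  Pascal's rule expresses it by row \<open>2 * m + 2\<close>.\<close>

lemma lower_sum_central: "2 * lower_sum (2 * m + 2) m + (2 * m + 2 choose (m + 1)) = 4 ^ (m + 1)"
proof -
  have "4 ^ (m + 1) = lower_sum (Suc (2 * m + 2)) (Suc m)"
    using lower_sum_half [of "m + 1"] by (simp add: eval_nat_numeral)
  also have "\<dots> = lower_sum (2 * m + 2) (Suc m) + lower_sum (2 * m + 2) m"
    by (rule lower_sum_Suc)
  also have "lower_sum (2 * m + 2) (Suc m) = lower_sum (2 * m + 2) m + (2 * m + 2 choose (m + 1))"
    by (simp add: lower_sum_def)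
  finally show ?thesis by simp
qed

text \<open>The Lichtenberg numbers 0, 1, 2, 5, 10, 21, that is,
  \<open>2 ^ (n + 1) div 3\<close>.\<close>

primrec jac :: "nat \<Rightarrow> nat" where
  "jac 0 = 0"
| "jac (Suc n) = 2 * jac n + of_bool (even n)"

text \<open>Chosen to satisfy the homogeneous form of the recursion of \<open>us\<close> and
  \<open>vs\<close> in \<open>k\<close> and \<open>l\<close>.\<close>

definition lower_sums :: "nat \<Rightarrow> nat \<Rightarrow> nat" where
  "lower_sums k l = (\<Sum>m<k. lower_sum (l + 2 * m + 1) m)"

lemma lower_sums_Suc:
  "lower_sums (Suc k) (Suc l) = lower_sums (Suc k) l + lower_sums k (l + 2)"
proof (induction k)
  case 0
  then show ?case by (simp add: lower_sums_def lower_sum_def)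
next
  case (Suc k)
  have S: "lower_sums (Suc k) l = lower_sums k l + lower_sum (l + 2 * k + 1) k" for k l
    by (simp add: lower_sums_def)
  have "lower_sum (Suc l + 2 * Suc k + 1) (Suc k) =
      lower_sum (l + 2 * Suc k + 1) (Suc k) + lower_sum (l + 2 + 2 * k + 1) k"
    using lower_sum_Suc [of "l + 2 * Suc k + 1" k] by simp
  then show ?case using Suc S [of "Suc k" "Suc l"] S [of "Suc k" l] S [of k "l + 2"] by linarith
qed

lemma jac_even: "jac (2 * k) = 2 * lower_sums k 0"
proof -
  have "3 * jac (2 * k) + 2 = 2 * 4 ^ k" by (induction k) auto
  moreover have "3 * lower_sums k 0 + 1 = 4 ^ k"
    unfolding lower_sums_def
  proof (induction k)
    case (Suc k)
    then show ?case using lower_sum_half [of k] by simp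
  qed simp
  ultimately show ?thesis by linarith
qed

text \<open>Subtracting the recursions leaves the correction \<open>of_bool (even l)\<close>, which
  \<open>jac\<close> absorbs; \<open>jac_even\<close> supplies the boundary
  \<open>l = 0\<close>.\<close>

lemma us_diff_vs: "us k l + 2 * lower_sums (Suc k) l = vs k l + 2 + jac (l + 2 * k + 2)"
proof (induction k arbitrary: l)
  case 0
  have "peak_pos (Suc l) = peak_pos l + jac (l + 2)"
  proof (induction l)
    case (Suc l)
    have "(l + 2) div 2 = (l + 1) div 2 + of_bool (even l)" by (cases "even l") auto
    then show ?case using Suc by simp
  qed simp
  then show ?case by (simp add: lower_sums_def lower_sum_def)
next
  case (Suc k)
  show ?case
  proof (induction l)
    case 0
    have "2 * lower_sums (Suc (Suc k)) 0 = jac (2 * Suc k + 2)"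
      using jac_even [of "Suc (Suc k)"] by simp
    then show ?case using us_0 [of "Suc k"] vs_0 [of "Suc k"] by (simp only: add_0) 
  next
    case IH: (Suc l)
    have "(l + 2) div 2 = (l + 1) div 2 + of_bool (even l)" by (cases "even l") auto
    moreover have "jac (Suc l + 2 * Suc k + 2) = 2 * jac (l + 2 * Suc k + 2) + of_bool (even l)"
      by simp
    moreover have "us k (l + 2) + 2 * lower_sums (Suc k) (l + 2) = vs k (l + 2) + 2 + jac (l + 2 * Suc k + 2)"
      using Suc.IH [of "l + 2"] by simp
    moreover have "us (Suc k) (Suc l) = us (Suc k) l + us k (l + 2) + (l + 2) div 2"
      "vs (Suc k) (Suc l) = vs (Suc k) l + vs k (l + 2) + 2 + (l + 1) div 2" by simp_all
    ultimately show ?case using IH lower_sums_Suc [of "Suc k" l] by linarith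
  qed
qed

definition gap :: "nat \<Rightarrow> nat" where
  "gap k = (\<Sum>m<k. 2 * m + 2 choose (m + 1))"

lemma us_1_vs_1: "us k 1 = vs k 1 + 3 + gap (Suc k)"
proof -
  have "2 * lower_sums (Suc k) 1 + gap (Suc k) = (\<Sum>m<Suc k. 4 ^ (m + 1))"
    unfolding lower_sums_def gap_def sum_distrib_left
    by (subst sum.distrib [symmetric]) (rule sum.cong, use lower_sum_central in \<open>auto simp: algebra_simps\<close>)
  moreover have "(\<Sum>m<Suc k. 4 ^ (m + 1)) + 1 = jac (1 + 2 * k + 2)"
  proof -
    have "3 * (\<Sum>m<Suc k. 4 ^ (m + 1)) + 4 = (4::nat) ^ (k + 2)" by (induction k) auto
    moreover have "3 * jac (1 + 2 * k + 2) + 1 = 4 ^ (k + 2)" by (induction k) auto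
    ultimately show ?thesis by linarith
  qed
  ultimately show ?thesis using us_diff_vs [of k 1] by linarith
qed

lemma peak_pos_even_le: "peak_pos (2 * k) + 2 \<le> 4 ^ Suc k"
proof -
  have "2 * peak_pos (2 * k) \<le> peak_pos (Suc (2 * k))" by simp
  then have "3 * peak_pos (2 * k) + 2 \<le> 2 ^ (2 * k + 3)" using peak_pos_add [of "2 * k"] by linarith
  also have "(2::nat) ^ (2 * k + 3) = 2 * 4 ^ Suc k" by (simp add: power_add power_mult)
  finally have "3 * peak_pos (2 * k) + 2 \<le> 2 * 4 ^ Suc k" .
  moreover have "(4::nat) \<le> 4 ^ Suc k" by simp
  ultimately show ?thesis by linarith
qed

lemma peak_pos_ge_power: "2 ^ Suc l \<le> peak_pos l"
  by (induction l) auto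

text \<open>The witnesses are \<open>us k 1 - 2\<close> and \<open>vs k 1 + 1\<close>. Both lie
  between \<open>peak_pos (2 * k + 1)\<close> and \<open>peak_pos (2 * k + 2)\<close>, so they share
  an even level, and only the delay of the \<open>True\<close> is rounded up.\<close>

lemma center_times:
  obtains s t where "occ True (4 ^ Suc k - 1) s" "occ False (4 ^ Suc k - 1) t"
    "s = t + gap (Suc k)" "delay s = delay t + 1"
proof -
  have c: "chain True 1 (us k)" "chain False 3 (vs k)" and s: "occ True (4 ^ Suc k - 1) (us k 1 - 2)"
    using center [of k] by (auto simp: center_def)
  have v0: "vs k 0 = 4 ^ Suc k - 2" "2 \<le> (4::nat) ^ Suc k"
    using vs_0 [of k] by linarith+
  have u: "occ True (4 ^ Suc k) (us k 1)"
    using c(1) [unfolded chain_def, THEN spec, of 0] us_0 [of k] by (simp add: run_start_def)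
  have v: "occ False (4 ^ Suc k - 2) (vs k 1)" "run False (vs k 1) 3"
    using c(2) [unfolded chain_def, THEN spec, of 0] v0 by (simp_all add: run_start_def)
  have t: "occ False (4 ^ Suc k - 1) (vs k 1 + 1)"
    using occ_in_run [OF v, of 1] v0(2) by (simp add: Suc_diff_Suc numeral_2_eq_2)
  have st: "us k 1 - 2 = vs k 1 + 1 + gap (Suc k)" using us_1_vs_1 [of k] by simp
  have "peak_pos (2 * k + 1) \<le> vs k 1"
  proof -
    have "occ False (peak_pos (2 * k)) (peak_pos (2 * k + 1))"
      using peak_pos_run_start [of "2 * k"] by (simp add: run_start_def del: peak_pos.simps)
    then show ?thesis using occ_less_iff [OF v(1)] peak_pos_even_le [of k] by fastforce
  qed
  moreover have "us k 1 \<le> peak_pos (2 * k + 2)"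
  proof -
    have "occ True (peak_pos (2 * k + 1)) (peak_pos (2 * k + 2))" using peak_pos_run_start [of "2 * k + 1"] by (simp add: run_start_def del: peak_pos.simps)
    moreover have "4 ^ Suc k \<le> peak_pos (2 * k + 1)" using peak_pos_ge_power [of "2 * k + 1"] by (simp add: power_mult)
    ultimately show ?thesis using occ_less_iff [OF _ u] by (meson leD leI)
  qed
  ultimately have "level i = 2 * k + 2" if "vs k 1 + 1 \<le> i" "i \<le> us k 1 - 2" for i
  proof -
    have "i < peak_pos (2 * k + 2)" "peak_pos (2 * k + 1) \<le> i"
      using that us_1_vs_1 [of k] \<open>us k 1 \<le> peak_pos (2 * k + 2)\<close> \<open>peak_pos (2 * k + 1) \<le> vs k 1\<close> by linarith+
    then show ?thesis
      using level_le_iff [of i "2 * k + 2"] less_level_iff [of "2 * k + 1" i] by linarith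
  qed
  then have "level (us k 1 - 2) = 2 * k + 2" "level (vs k 1 + 1) = 2 * k + 2" using st by auto
  then have "delay (us k 1 - 2) = delay (vs k 1 + 1) + 1"
    using occ_letter [OF s] occ_letter [OF t] by (simp add: delay_def)
  with s t st show thesis using that by blast
qed

section \<open>Frequencies of the values of \<open>A\<close> and \<open>B\<close>\<close>

lemma A_eq: "1 \<le> m \<Longrightarrow> A m = int (num True (incs (2 * m - 1))) + 1"
  by (simp add: A_def Qt_eq)

lemma B_eq: "1 \<le> m \<Longrightarrow> B m = int (num False (incs (2 * m))) + 1"
  by (simp add: B_def Qt_eq)

text \<open>The times of the two increments are \<open>2 * a + 1\<close> and \<open>2 * b\<close>,
  differing by \<open>2 * gap k - 1\<close>. The delay difference and the odd index cancel, leaving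
  exactly \<open>gap k\<close>.\<close>

lemma first_times:
  obtains a b where "1 \<le> a" "1 \<le> b" "int a = int b + int (gap k)"
    "\<And>m. 1 \<le> m \<Longrightarrow> int (4 ^ k) \<le> A m \<longleftrightarrow> a \<le> m" "\<And>m. 1 \<le> m \<Longrightarrow> int (4 ^ k) \<le> B m \<longleftrightarrow> b \<le> m"
proof (cases k)
  case 0
  then show thesis by (intro that [of 1 1]) (auto simp: A_eq B_eq gap_def)
next
  case (Suc k')
  obtain s t where s: "occ True (4 ^ k - 1) s" and t: "occ False (4 ^ k - 1) t"
    and st: "s = t + gap k" "delay s = delay t + 1"
    using center_times [of k'] Suc by blast
  have "odd (time s)" "even (time t)" using s t by (auto simp: even_time occ_def)
  then obtain a b where a: "time s = 2 * a + 1" and b: "time t = 2 * b" by (metis oddE evenE)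
  have "3 \<le> time s" "3 \<le> time t"
    using time_ge [of s] time_ge [of t] occ_pos [OF s] occ_pos [OF t] by auto
  then have pos: "0 \<le> a" "1 \<le> b" using a b by auto
  have A: "int (4 ^ k) \<le> A m \<longleftrightarrow> nat (a + 1) \<le> m" if "1 \<le> m" for m
  proof -
    \<comment> \<open>\<open>A\<close> starts at 1, so it reaches \<open>4 ^ k\<close> with the
      \<open>(4 ^ k - 1)\<close>-th \<open>True\<close>.\<close>
    have "int (4 ^ k) \<le> A m \<longleftrightarrow> 4 ^ k - 1 \<le> num True (incs (2 * m - 1))"
      unfolding A_eq [OF that] by linarith
    also have "\<dots> \<longleftrightarrow> time s \<le> int (2 * m - 1)"
      using occ_le_iff [OF s] le_incs_iff [OF occ_pos [OF s]] by simp
    also have "\<dots> \<longleftrightarrow> nat (a + 1) \<le> m" using a pos that by auto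
    finally show ?thesis .
  qed
  have B: "int (4 ^ k) \<le> B m \<longleftrightarrow> nat b \<le> m" if "1 \<le> m" for m
  proof -
    have "int (4 ^ k) \<le> B m \<longleftrightarrow> 4 ^ k - 1 \<le> num False (incs (2 * m))"
      unfolding B_eq [OF that] by linarith
    also have "\<dots> \<longleftrightarrow> time t \<le> int (2 * m)"
      using occ_le_iff [OF t] le_incs_iff [OF occ_pos [OF t]] by simp
    also have "\<dots> \<longleftrightarrow> nat b \<le> m" using b pos that by auto
    finally show ?thesis .
  qed
  have "a + 1 = b + int (gap k)" using a b st by (simp add: time_def)
  then show thesis using A B pos by (intro that [of "nat (a + 1)" "nat b"]) auto
qed

text \<open>The level sets for the values from \<open>lo\<close> to \<open>hi - 1\<close> partition
  the interval from \<open>a\<close> to \<open>b - 1\<close>.\<close>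

lemma sum_card_level:
  fixes f :: "nat \<Rightarrow> int" and lo hi a b :: nat
  assumes "1 \<le> a" "lo < hi"
    and a: "\<And>m. 1 \<le> m \<Longrightarrow> int lo \<le> f m \<longleftrightarrow> a \<le> m" and b: "\<And>m. 1 \<le> m \<Longrightarrow> int hi \<le> f m \<longleftrightarrow> b \<le> m"
  shows "(\<Sum>v = lo..hi - 1. card {m. m \<ge> 1 \<and> f m = int v}) = b - a"
proof -
  have un: "(\<Union>v\<in>{lo..hi - 1}. {m. m \<ge> 1 \<and> f m = int v}) = {a..<b}"
  proof (intro set_eqI iffI)
    fix m assume "m \<in> (\<Union>v\<in>{lo..hi - 1}. {m. m \<ge> 1 \<and> f m = int v})"
    then have "1 \<le> m" "int lo \<le> f m" "\<not> int hi \<le> f m" using assms(2) by auto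
    then show "m \<in> {a..<b}" using a [of m] b [of m] by simp
  next
    fix m assume m: "m \<in> {a..<b}"
    then have "1 \<le> m" "int lo \<le> f m" "\<not> int hi \<le> f m" using a [of m] b [of m] assms(1) by auto
    then have "m \<in> {m. m \<ge> 1 \<and> f m = int (nat (f m))}" "nat (f m) \<in> {lo..hi - 1}" by auto
    then show "m \<in> (\<Union>v\<in>{lo..hi - 1}. {m. m \<ge> 1 \<and> f m = int v})" by blast
  qed
  have "finite {m. m \<ge> 1 \<and> f m = int v}" if "v \<in> {lo..hi - 1}" for v
    by (rule finite_subset [of _ "{a..<b}"]) (use un that in auto)
  then have "card (\<Union>v\<in>{lo..hi - 1}. {m. m \<ge> 1 \<and> f m = int v}) =
      (\<Sum>v = lo..hi - 1. card {m. m \<ge> 1 \<and> f m = int v})"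
    by (intro card_UN_disjoint) auto
  then show ?thesis unfolding un by simp
qed

theorem theorem7p9:
  fixes k :: nat
  shows "(\<Sum>v = 4 ^ k..4 ^ (k + 1) - 1. int (F_A v) - int (F_B v))
           = int ((2 * k + 2) choose (k + 1))"
proof -
  obtain a b where ab: "1 \<le> a" "1 \<le> b" "int a = int b + int (gap k)"
    and a: "\<And>m. 1 \<le> m \<Longrightarrow> int (4 ^ k) \<le> A m \<longleftrightarrow> a \<le> m"
    and b: "\<And>m. 1 \<le> m \<Longrightarrow> int (4 ^ k) \<le> B m \<longleftrightarrow> b \<le> m"
    by (rule first_times [of k]) blast
  obtain a' b' where ab': "1 \<le> a'" "1 \<le> b'" "int a' = int b' + int (gap (k + 1))"
    and a': "\<And>m. 1 \<le> m \<Longrightarrow> int (4 ^ (k + 1)) \<le> A m \<longleftrightarrow> a' \<le> m"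
    and b': "\<And>m. 1 \<le> m \<Longrightarrow> int (4 ^ (k + 1)) \<le> B m \<longleftrightarrow> b' \<le> m"
    by (rule first_times [of "k + 1"]) blast
  have lt: "(4::nat) ^ k < 4 ^ (k + 1)" by simp
  have le: "int (4 ^ k) \<le> int (4 ^ (k + 1))" using lt by linarith
  have "int (4 ^ k) \<le> A a'" using a' [OF ab'(1)] le by linarith
  \<comment> \<open>The order of the thresholds makes the natural-number differences exact.\<close>
  then have "a \<le> a'" using a [of a'] ab'(1) by simp
  have "int (4 ^ k) \<le> B b'" using b' [OF ab'(2)] le by linarith
  then have "b \<le> b'" using b [of b'] ab'(2) by simp
  have "(\<Sum>v = 4 ^ k..4 ^ (k + 1) - 1. F_A v) = a' - a"
    unfolding F_A_def by (rule sum_card_level [OF ab(1) lt a a'])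
  moreover have "(\<Sum>v = 4 ^ k..4 ^ (k + 1) - 1. F_B v) = b' - b"
    unfolding F_B_def by (rule sum_card_level [OF ab(2) lt b b'])
  ultimately have "(\<Sum>v = 4 ^ k..4 ^ (k + 1) - 1. int (F_A v) - int (F_B v)) = int (a' - a) - int (b' - b)"
    by (simp add: sum_subtractf flip: of_nat_sum)
  also have "\<dots> = int (gap (k + 1)) - int (gap k)"
    using ab(3) ab'(3) \<open>a \<le> a'\<close> \<open>b \<le> b'\<close> by simp
  also have "\<dots> = int ((2 * k + 2) choose (k + 1))"
    by (simp add: gap_def)
  finally show ?thesis .
qed

end
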